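(* Let $(B,+,\cdot)$ be a skew left brace with additive group $K=(B,+)$, multiplicative group $C=(B,\cdot)$ and lambda map $\lambda\colon C\to\operatorname{Aut}(K)$. Let $\Omega=\{N\unlhd C\mid N\le\ker\lambda\}$, on which the group $\operatorname{Aut}(B,+,\cdot)$ of brace automorphisms acts by $f\bullet N=f(N)$. Then there is a bijection between the set of isomorphism classes of trifactorised groups associated with $(B,+,\cdot)$ and the set of orbits of the action of $\operatorname{Aut}(B,+,\cdot)$ on $\Omega$; it associates to the orbit of $N\in\Omega$ the (isomorphism class of the) trifactorised group associated with $(B,+,\cdot)$ corresponding to the natural epimorphism $\eta_N\colon C\to C/N$.
   Context: A skew left brace $(B,+,\cdot)$ is a set with two group operations ($+$ not necessarily commutative) such that $a(b+c)=ab-a+ac$ for all $a,b,c\in B$. Its lambda map is the homomorphism $\lambda\colon (B,\cdot)\to\operatorname{Aut}(B,+)$, $\lambda_a(b)=-a+ab$. A brace homomorphism is a map preserving both operations. A trifactorised group is a tuple $(G,K,H,E)$ with $G$ a group, $K\trianglelefteq G$, $H,E\le G$, $G=KE=KH=HE$ and $K\cap E=H\cap E=1$. A morphism $(G_1,K_1,H_1,E_1)\to(G_2,K_2,H_2,E_2)$ is a group homomorphism $f\colon G_1\to G_2$ with $f(K_1)\le K_2$, $f(H_1)\le H_2$, $f(E_1)\le E_2$; isomorphism is meant with respect to these morphisms (a bijective morphism). Trifactorised groups associated with a brace: let $K=(B,+)$, $C=(B,\cdot)$, let $\delta\colon C\to K$ be the identity map of $B$, and let $\eta\colon C\to E$ be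 a surjective group homomorphism with $\ker\eta\le\ker\lambda$. Then $E$ acts on $K$ by $\bar\lambda(\eta(c))=\lambda(c)$; put $G=K\rtimes E$ (with $K$, $E$ identified with their copies in $G$) and $H=\{\delta(c)\eta(c)\mid c\in C\}\le G$. The tuple $(G,K,H,E)$ is the trifactorised group associated with $B$ corresponding to $\eta$. The action on $\Omega$ is well defined because $f(\ker\lambda)=\ker\lambda$ for every brace automorphism $f$. *)

theory Defs
  imports "HOL-Algebra.Group_Action" "HOL-Algebra.Ring"
begin

text \<open>A skew left brace is carried by a record of type \<open>ring\<close>, used only for its signature: the
  additive group is \<open>add_monoid B\<close> (not assumed commutative), and the multiplicative group is \<open>B\<close>
  itself regarded as a monoid record.\<close>

locale skew_left_brace =
  fixes B (structure)
  assumes additive_group: "group (add_monoid B)"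
    and multiplicative_group: "group B"
    and brace_distrib: "\<And>a b c. \<lbrakk>a \<in> carrier B; b \<in> carrier B; c \<in> carrier B\<rbrakk> \<Longrightarrow>
          a \<otimes> (b \<oplus> c) = a \<otimes> b \<ominus> a \<oplus> a \<otimes> c"

text \<open>The restriction makes \<open>brace_lambda B a\<close> an element of \<open>AutoGroup (add_monoid B)\<close>, whose
  members are extensional on the carrier.\<close>

definition brace_lambda :: "('a, 'm) ring_scheme \<Rightarrow> 'a \<Rightarrow> 'a \<Rightarrow> 'a" where
  "brace_lambda B a = (\<lambda>b \<in> carrier B. \<ominus>\<^bsub>B\<^esub> a \<oplus>\<^bsub>B\<^esub> a \<otimes>\<^bsub>B\<^esub> b)"

abbreviation ker_lambda :: "('a, 'm) ring_scheme \<Rightarrow> 'a set" where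
  "ker_lambda B \<equiv> kernel B (AutoGroup (add_monoid B)) (brace_lambda B)"

definition brace_auto :: "('a, 'm) ring_scheme \<Rightarrow> ('a \<Rightarrow> 'a) set" where
  "brace_auto B = auto B \<inter> auto (add_monoid B)"

definition brace_AutoGroup :: "('a, 'm) ring_scheme \<Rightarrow> ('a \<Rightarrow> 'a) monoid" where
  "brace_AutoGroup B = BijGroup (carrier B) \<lparr>carrier := brace_auto B\<rparr>"

definition Omega :: "('a, 'm) ring_scheme \<Rightarrow> 'a set set" where
  "Omega B = {N. N \<lhd> B \<and> N \<subseteq> ker_lambda B}"

definition Omega_action :: "('a, 'm) ring_scheme \<Rightarrow> ('a \<Rightarrow> 'a) \<Rightarrow> 'a set \<Rightarrow> 'a set" where
  "Omega_action B f = (\<lambda>N \<in> Omega B. f ` N)"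

record 'g trifact =
  ambient :: "'g monoid"
  partK :: "'g set"
  partH :: "'g set"
  partE :: "'g set"

definition trifactorised_group :: "'g trifact \<Rightarrow> bool" where
  "trifactorised_group T \<longleftrightarrow>
     group (ambient T) \<and> partK T \<lhd> ambient T \<and>
     subgroup (partH T) (ambient T) \<and> subgroup (partE T) (ambient T) \<and>
     partK T <#>\<^bsub>ambient T\<^esub> partE T = carrier (ambient T) \<and>
     partK T <#>\<^bsub>ambient T\<^esub> partH T = carrier (ambient T) \<and>
     partH T <#>\<^bsub>ambient T\<^esub> partE T = carrier (ambient T) \<and>
     partK T \<inter> partE T = {\<one>\<^bsub>ambient T\<^esub>} \<and>
     partH T \<inter> partE T = {\<one>\<^bsub>ambient T\<^esub>}"

definition trifact_morphism :: "'g trifact \<Rightarrow> 'h trifact \<Rightarrow> ('g \<Rightarrow> 'h) set" where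
  "trifact_morphism S T =
     {f \<in> hom (ambient S) (ambient T).
        f ` partK S \<subseteq> partK T \<and> f ` partH S \<subseteq> partH T \<and> f ` partE S \<subseteq> partE T}"

definition trifact_iso :: "'g trifact \<Rightarrow> 'h trifact \<Rightarrow> bool"  (infix \<open>\<cong>\<^sub>T\<close> 50) where
  "S \<cong>\<^sub>T T \<longleftrightarrow>
     (\<exists>f \<in> trifact_morphism S T. bij_betw f (carrier (ambient S)) (carrier (ambient T)))"

definition semidirect ::
  "('a, 'm) monoid_scheme \<Rightarrow> ('e, 'n) monoid_scheme \<Rightarrow> ('e \<Rightarrow> 'a \<Rightarrow> 'a) \<Rightarrow> ('a \<times> 'e) monoid" where
  "semidirect K E \<phi> =
     \<lparr>carrier = carrier K \<times> carrier E,
      mult = (\<lambda>(k, e) (k', e'). (k \<otimes>\<^bsub>K\<^esub> \<phi> e k', e \<otimes>\<^bsub>E\<^esub> e')),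
      one = (\<one>\<^bsub>K\<^esub>, \<one>\<^bsub>E\<^esub>)\<rparr>"

definition admissible :: "('a, 'm) ring_scheme \<Rightarrow> 'e monoid \<Rightarrow> ('a \<Rightarrow> 'e) \<Rightarrow> bool" where
  "admissible B E \<eta> \<longleftrightarrow> group E \<and> \<eta> \<in> epi B E \<and> kernel B E \<eta> \<subseteq> ker_lambda B"

text \<open>The action of \<open>E\<close> on the additive group determined by \<open>induced_action B \<eta> (\<eta> c) = brace_lambda B c\<close>;
  see \<open>induced_action_eq\<close> below.\<close>

definition induced_action :: "('a, 'm) ring_scheme \<Rightarrow> ('a \<Rightarrow> 'e) \<Rightarrow> 'e \<Rightarrow> 'a \<Rightarrow> 'a" where
  "induced_action B \<eta> e = the_elem (brace_lambda B ` {c \<in> carrier B. \<eta> c = e})"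

text \<open>\<open>(c, \<one>)\<close> and \<open>(\<zero>, \<eta> c)\<close> are the copies of \<open>\<delta> c = c\<close> and \<open>\<eta> c\<close> in the semidirect product.\<close>

definition associated_trifact ::
  "('a, 'm) ring_scheme \<Rightarrow> 'e monoid \<Rightarrow> ('a \<Rightarrow> 'e) \<Rightarrow> ('a \<times> 'e) trifact" where
  "associated_trifact B E \<eta> =
     (let G = semidirect (add_monoid B) E (induced_action B \<eta>) in
      \<lparr>ambient = G,
       partK = carrier B \<times> {\<one>\<^bsub>E\<^esub>},
       partH = {(c, \<one>\<^bsub>E\<^esub>) \<otimes>\<^bsub>G\<^esub> (\<zero>\<^bsub>B\<^esub>, \<eta> c) | c. c \<in> carrier B},
       partE = {\<zero>\<^bsub>B\<^esub>} \<times> carrier E\<rparr>)"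

abbreviation natural_trifact :: "('a, 'm) ring_scheme \<Rightarrow> 'a set \<Rightarrow> ('a \<times> 'a set) trifact" where
  "natural_trifact B N \<equiv> associated_trifact B (B Mod N) (\<lambda>c. N #>\<^bsub>B\<^esub> c)"

text \<open>The groups \<open>E\<close> range over one type \<open>'e\<close>. Up to isomorphism nothing is lost at \<open>'e = 'a set\<close>,
  since \<open>E\<close> is isomorphic to the quotient of the multiplicative group by \<open>kernel B E \<eta>\<close>.\<close>

definition associated_trifacts :: "('a, 'm) ring_scheme \<Rightarrow> ('a \<times> 'e) trifact set" where
  "associated_trifacts B = {associated_trifact B E \<eta> | E \<eta>. admissible B E \<eta>}"

definition iso_class :: "('a, 'm) ring_scheme \<Rightarrow> ('a \<times> 'e) trifact \<Rightarrow> ('a \<times> 'e) trifact set" where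
  "iso_class B S = {T \<in> associated_trifacts B. S \<cong>\<^sub>T T}"

definition iso_classes :: "('a, 'm) ring_scheme \<Rightarrow> ('a \<times> 'e) trifact set set" where
  "iso_classes B = iso_class B ` associated_trifacts B"

context skew_left_brace
begin

interpretation add: group "add_monoid B"
  rewrites "carrier (add_monoid B) = carrier B"
    and "mult (add_monoid B) = add B"
    and "one (add_monoid B) = zero B"
    and "m_inv (add_monoid B) = a_inv B"
  using additive_group by (auto simp: a_inv_def fun_eq_iff)

interpretation mul: group B
  by (rule multiplicative_group)

lemma l_neg_cancel: "x \<in> carrier B \<Longrightarrow> y \<in> carrier B \<Longrightarrow> x \<oplus> (\<ominus> x \<oplus> y) = y"
  by (metis add.inv_closed add.l_one add.m_assoc add.r_inv)

lemma l_neg_cancel': "x \<in> carrier B \<Longrightarrow> y \<in> carrier B \<Longrightarrow> \<ominus> x \<oplus> (x \<oplus> y) = y"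
  by (metis add.inv_closed add.l_one add.m_assoc add.l_inv)

lemma lambda_eq: "b \<in> carrier B \<Longrightarrow> brace_lambda B a b = \<ominus> a \<oplus> a \<otimes> b"
  by (simp add: brace_lambda_def)

lemma lambda_closed: "\<lbrakk>a \<in> carrier B; b \<in> carrier B\<rbrakk> \<Longrightarrow> brace_lambda B a b \<in> carrier B"
  by (simp add: lambda_eq)

lemma mult_lambda: "\<lbrakk>a \<in> carrier B; b \<in> carrier B\<rbrakk> \<Longrightarrow> a \<otimes> b = a \<oplus> brace_lambda B a b"
  by (simp add: lambda_eq l_neg_cancel)

lemma lambda_add:
  assumes "a \<in> carrier B" "b \<in> carrier B" "c \<in> carrier B"
  shows "brace_lambda B a (b \<oplus> c) = brace_lambda B a b \<oplus> brace_lambda B a c"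
  using assms by (simp add: lambda_eq brace_distrib a_minus_def add.m_assoc)

lemma lambda_mult:
  assumes "a \<in> carrier B" "b \<in> carrier B" "c \<in> carrier B"
  shows "brace_lambda B (a \<otimes> b) c = brace_lambda B a (brace_lambda B b c)"
proof -
  have "a \<otimes> b \<oplus> brace_lambda B (a \<otimes> b) c = a \<otimes> (b \<oplus> brace_lambda B b c)"
    using assms by (simp add: mult_lambda[symmetric] mul.m_assoc)
  also have "\<dots> = a \<otimes> b \<oplus> brace_lambda B a (brace_lambda B b c)"
    using assms
    by (simp add: brace_distrib lambda_closed a_minus_def add.m_assoc
        lambda_eq[of "brace_lambda B b c" a])
  finally show ?thesis
    using assms by (simp add: lambda_closed)
qed

lemma one_eq_zero: "\<one> = \<zero>"
proof -
  have "\<one> \<otimes> (\<one> \<oplus> \<one>) = \<one> \<otimes> \<one> \<ominus> \<one> \<oplus> \<one> \<otimes> \<one>"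
    by (rule brace_distrib) auto
  then have "\<one> \<oplus> \<one> = \<zero> \<oplus> \<one>"
    by (simp add: a_minus_def)
  then show ?thesis
    using add.right_cancel[of \<one> \<one> \<zero>] by simp
qed

lemma lambda_one: "b \<in> carrier B \<Longrightarrow> brace_lambda B \<one> b = b"
  using mult_lambda[of \<one> b] by (simp add: one_eq_zero lambda_closed lambda_eq)

lemma lambda_Bij:
  assumes "a \<in> carrier B"
  shows "brace_lambda B a \<in> Bij (carrier B)"
proof -
  have "bij_betw (brace_lambda B a) (carrier B) (carrier B)"
    by (rule bij_betw_byWitness[where f' = "brace_lambda B (inv a)"])
      (use assms in \<open>auto simp: lambda_mult[symmetric] lambda_one lambda_closed\<close>)
  then show ?thesis
    by (simp add: Bij_def brace_lambda_def)
qed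

lemma lambda_hom: "brace_lambda B \<in> hom B (AutoGroup (add_monoid B))"
proof (rule homI)
  show "brace_lambda B a \<in> carrier (AutoGroup (add_monoid B))" if "a \<in> carrier B" for a
    using that by (simp add: AutoGroup_def auto_def hom_def lambda_Bij lambda_add lambda_closed)
  show "brace_lambda B (a \<otimes> b) =
      brace_lambda B a \<otimes>\<^bsub>AutoGroup (add_monoid B)\<^esub> brace_lambda B b"
    if "a \<in> carrier B" "b \<in> carrier B" for a b
  proof
    fix c
    show "brace_lambda B (a \<otimes> b) c =
        (brace_lambda B a \<otimes>\<^bsub>AutoGroup (add_monoid B)\<^esub> brace_lambda B b) c"
      using that
      by (cases "c \<in> carrier B")
        (simp_all add: AutoGroup_def BijGroup_def lambda_Bij compose_def lambda_mult,
          simp add: brace_lambda_def)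
  qed
qed

lemma ker_lambda_iff:
  "c \<in> ker_lambda B \<longleftrightarrow> c \<in> carrier B \<and> (\<forall>b\<in>carrier B. brace_lambda B c b = b)"
  by (auto simp: kernel_def AutoGroup_def BijGroup_def brace_lambda_def fun_eq_iff restrict_def)

lemma induced_action_eq:
  assumes "admissible B E \<eta>" "c \<in> carrier B"
  shows "induced_action B \<eta> (\<eta> c) = brace_lambda B c"
proof -
  interpret E: group E using assms by (simp add: admissible_def)
  interpret \<eta>: group_hom B E \<eta>
    using assms by unfold_locales (simp add: admissible_def epi_def)
  have "brace_lambda B d = brace_lambda B c" if d: "d \<in> carrier B" "\<eta> d = \<eta> c" for d
  proof -
    have "inv c \<otimes> d \<in> kernel B E \<eta>"
      using assms d by (simp add: kernel_def)
    then have k: "inv c \<otimes> d \<in> ker_lambda B"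
      using assms by (auto simp: admissible_def)
    have "brace_lambda B d b = brace_lambda B c b" for b
    proof (cases "b \<in> carrier B")
      case True
      have "brace_lambda B d b = brace_lambda B (c \<otimes> (inv c \<otimes> d)) b"
        using assms d by (simp add: mul.m_assoc[symmetric])
      also have "\<dots> = brace_lambda B c b"
        using assms d True k by (subst lambda_mult) (auto simp: ker_lambda_iff)
      finally show ?thesis .
    qed (simp add: brace_lambda_def)
    then show ?thesis by blast
  qed
  then have "brace_lambda B ` {d \<in> carrier B. \<eta> d = \<eta> c} = {brace_lambda B c}"
    using assms(2) by blast
  then show ?thesis by (simp add: induced_action_def)
qed

theorem associated_trifactorised:
  assumes adm: "admissible B E \<eta>"
  shows "trifactorised_group (associated_trifact B E \<eta>)"
proof -
  interpret E: group E using adm by (simp add: admissible_def)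
  interpret \<eta>: group_hom B E \<eta>
    using adm by unfold_locales (simp add: admissible_def epi_def)
  note act = induced_action_eq[OF adm]
  have surj: "\<exists>c\<in>carrier B. e = \<eta> c" if "e \<in> carrier E" for e
    using adm that by (auto simp: admissible_def epi_def)
  have act1: "induced_action B \<eta> \<one>\<^bsub>E\<^esub> = brace_lambda B \<one>"
    using act[of \<one>] by simp
  have lam0: "brace_lambda B c \<zero> = \<zero>" if "c \<in> carrier B" for c
    using that by (simp add: lambda_eq flip: one_eq_zero)
  have laminv: "brace_lambda B c (brace_lambda B (inv c) b) = b"
      "brace_lambda B (inv c) (brace_lambda B c b) = b"
    if "c \<in> carrier B" "b \<in> carrier B" for b c
    using that by (auto simp: lambda_mult[symmetric] lambda_one)
  define G where "G = semidirect (add_monoid B) E (induced_action B \<eta>)"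
  have carG: "carrier G = carrier B \<times> carrier E" and oneG: "\<one>\<^bsub>G\<^esub> = (\<zero>, \<one>\<^bsub>E\<^esub>)"
    by (simp_all add: G_def semidirect_def)
  have multG: "(k, \<eta> c) \<otimes>\<^bsub>G\<^esub> (k', e') = (k \<oplus> brace_lambda B c k', \<eta> c \<otimes>\<^bsub>E\<^esub> e')"
    if "c \<in> carrier B" for k c k' e'
    using that by (simp add: G_def semidirect_def act)
  have multG1: "(k, \<one>\<^bsub>E\<^esub>) \<otimes>\<^bsub>G\<^esub> (k', e') = (k \<oplus> k', \<one>\<^bsub>E\<^esub> \<otimes>\<^bsub>E\<^esub> e')"
    if "k' \<in> carrier B" for k k' e'
    using that by (simp add: G_def semidirect_def act1 lambda_one)
  interpret G: group G
  proof (rule groupI)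
    fix x y assume "x \<in> carrier G" "y \<in> carrier G"
    then show "x \<otimes>\<^bsub>G\<^esub> y \<in> carrier G"
      by (auto simp: carG multG lambda_closed dest!: surj)
  next
    show "\<one>\<^bsub>G\<^esub> \<in> carrier G" by (simp add: carG oneG)
  next
    fix x y z assume *: "x \<in> carrier G" "y \<in> carrier G" "z \<in> carrier G"
    obtain a a' where x: "x = (a, \<eta> a')" "a \<in> carrier B" "a' \<in> carrier B"
      using * surj by (force simp: carG)
    obtain b b' where y: "y = (b, \<eta> b')" "b \<in> carrier B" "b' \<in> carrier B"
      using * surj by (force simp: carG)
    obtain c c' where z: "z = (c, \<eta> c')" "c \<in> carrier B" "c' \<in> carrier B"
      using * surj by (force simp: carG)
    show "x \<otimes>\<^bsub>G\<^esub> y \<otimes>\<^bsub>G\<^esub> z = x \<otimes>\<^bsub>G\<^esub> (y \<otimes>\<^bsub>G\<^esub> z)"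
      using x y z
      by (simp add: multG lambda_closed lambda_add lambda_mult add.m_assoc E.m_assoc
          flip: \<eta>.hom_mult)
        (simp add: mul.m_assoc)
  next
    fix x assume "x \<in> carrier G"
    then show "\<one>\<^bsub>G\<^esub> \<otimes>\<^bsub>G\<^esub> x = x"
      by (auto simp: carG oneG multG1)
  next
    fix x assume *: "x \<in> carrier G"
    obtain a a' where x: "x = (a, \<eta> a')" "a \<in> carrier B" "a' \<in> carrier B"
      using * surj by (force simp: carG)
    have "(brace_lambda B (inv a') (\<ominus> a), \<eta> (inv a')) \<otimes>\<^bsub>G\<^esub> x = \<one>\<^bsub>G\<^esub>"
      using x lam0[of "inv a'"]
      by (simp add: oneG multG flip: lambda_add \<eta>.hom_mult del: \<eta>.hom_inv)
    then show "\<exists>y\<in>carrier G. y \<otimes>\<^bsub>G\<^esub> x = \<one>\<^bsub>G\<^esub>"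
      using x by (intro bexI) (auto simp: carG lambda_closed)
  qed
  let ?K = "carrier B \<times> {\<one>\<^bsub>E\<^esub>}" and ?E = "{\<zero>} \<times> carrier E"
  have H: "{(c, \<one>\<^bsub>E\<^esub>) \<otimes>\<^bsub>G\<^esub> (\<zero>, \<eta> c) | c. c \<in> carrier B} = (\<lambda>c. (c, \<eta> c)) ` carrier B"
    unfolding Setcompr_eq_image by (rule image_cong) (auto simp: multG1)
  have snd_hom: "group_hom G E snd"
  proof unfold_locales
    show "snd \<in> hom G E"
      by (auto simp: hom_def G_def semidirect_def)
  qed
  have K_eq: "?K = kernel G E snd"
    by (auto simp: kernel_def carG)
  have K: "?K \<lhd> G"
    unfolding K_eq using snd_hom by (rule group_hom.normal_kernel)
  have sub_H: "subgroup ((\<lambda>c. (c, \<eta> c)) ` carrier B) G"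
  proof -
    have "group_hom B G (\<lambda>c. (c, \<eta> c))"
      by unfold_locales (auto simp: hom_def carG multG mult_lambda[symmetric])
    then show ?thesis by (rule group_hom.img_is_subgroup)
  qed
  have sub_E: "subgroup ?E G"
  proof -
    have "group_hom E G (\<lambda>e. (\<zero>, e))"
      using surj by unfold_locales (force simp: hom_def carG multG lam0)
    then have "subgroup ((\<lambda>e. (\<zero>, e)) ` carrier E) G" by (rule group_hom.img_is_subgroup)
    then show ?thesis 
      by (rule back_subst[of "\<lambda>S. subgroup S G"]) auto
  qed
  have KE: "?K <#>\<^bsub>G\<^esub> ?E = carrier G"
    by (force simp: set_mult_def multG1 carG)
  have KH: "?K <#>\<^bsub>G\<^esub> (\<lambda>c. (c, \<eta> c)) ` carrier B = carrier G"
  proof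
    show "carrier G \<subseteq> ?K <#>\<^bsub>G\<^esub> (\<lambda>c. (c, \<eta> c)) ` carrier B"
    proof
      fix x assume "x \<in> carrier G"
      then obtain a c where x: "x = (a, \<eta> c)" "a \<in> carrier B" "c \<in> carrier B"
        using surj by (force simp: carG)
      then have "x = (a \<oplus> \<ominus> c, \<one>\<^bsub>E\<^esub>) \<otimes>\<^bsub>G\<^esub> (c, \<eta> c)"
        by (simp add: multG1 add.m_assoc)
      moreover have "a \<oplus> \<ominus> c \<in> carrier B"
        using x by simp
      ultimately show "x \<in> ?K <#>\<^bsub>G\<^esub> (\<lambda>c. (c, \<eta> c)) ` carrier B"
        using x(3) unfolding set_mult_def by blast
    qed
  qed (auto simp: set_mult_def multG1 carG)
  have HE: "(\<lambda>c. (c, \<eta> c)) ` carrier B <#>\<^bsub>G\<^esub> ?E = carrier G"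
  proof
    show "carrier G \<subseteq> (\<lambda>c. (c, \<eta> c)) ` carrier B <#>\<^bsub>G\<^esub> ?E"
    proof
      fix x assume "x \<in> carrier G"
      then obtain a e where x: "x = (a, e)" "a \<in> carrier B" "e \<in> carrier E"
        by (force simp: carG)
      then have "x = (a, \<eta> a) \<otimes>\<^bsub>G\<^esub> (\<zero>, inv\<^bsub>E\<^esub> (\<eta> a) \<otimes>\<^bsub>E\<^esub> e)"
        by (simp add: multG lam0 flip: E.m_assoc)
      moreover have "inv\<^bsub>E\<^esub> (\<eta> a) \<otimes>\<^bsub>E\<^esub> e \<in> carrier E"
        using x by simp
      ultimately show "x \<in> (\<lambda>c. (c, \<eta> c)) ` carrier B <#>\<^bsub>G\<^esub> ?E"
        using x(2) unfolding set_mult_def by blast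
    qed
  qed (auto simp: set_mult_def multG carG lam0)
  have "(\<lambda>c. (c, \<eta> c)) ` carrier B \<inter> ?E = {\<one>\<^bsub>G\<^esub>}"
    by (auto simp: oneG image_iff simp flip: one_eq_zero)
  moreover have "?K \<inter> ?E = {\<one>\<^bsub>G\<^esub>}"
    by (auto simp: oneG)
  ultimately show ?thesis
    using K sub_H sub_E KE KH HE G.is_group
    by (simp add: trifactorised_group_def associated_trifact_def Let_def H flip: G_def)
qed

lemma natural_admissible:
  assumes "N \<in> Omega B"
  shows "admissible B (B Mod N) (\<lambda>c. N #> c)"
proof -
  interpret N: normal N B using assms by (simp add: Omega_def)
  have "kernel B (B Mod N) (\<lambda>c. N #> c) \<subseteq> N"
    using mul.rcos_self[OF _ N.is_subgroup] by (auto simp: kernel_def)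
  then show ?thesis
    using assms N.factorgroup_is_group N.r_coset_hom_Mod
    by (auto simp: admissible_def epi_def carrier_FactGroup Omega_def)
qed

lemma brace_AutoGroup: "group (brace_AutoGroup B)"
proof -
  have "subgroup (brace_auto B) (BijGroup (carrier B))"
    unfolding brace_auto_def using add.subgroup_auto
    by (intro group.subgroups_Inter_pair group_BijGroup mul.subgroup_auto) simp
  then show ?thesis
    by (simp add: brace_AutoGroup_def subgroup.subgroup_is_group group_BijGroup)
qed

lemma brace_auto_lambda:
  assumes f: "f \<in> brace_auto B" and "c \<in> carrier B" "b \<in> carrier B"
  shows "brace_lambda B (f c) (f b) = f (brace_lambda B c b)"
proof -
  have hom: "f \<in> hom B B" "f \<in> hom (add_monoid B) (add_monoid B)"
    using f by (auto simp: brace_auto_def auto_def)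
  have cl: "f x \<in> carrier B" if "x \<in> carrier B" for x
    using hom(1) that by (auto simp: hom_def)
  have "f (c \<oplus> brace_lambda B c b) = f c \<oplus> f (brace_lambda B c b)"
    using hom(2) assms by (simp add: hom_def lambda_closed)
  moreover have "f (c \<oplus> brace_lambda B c b) = f c \<oplus> brace_lambda B (f c) (f b)"
    using hom(1) assms by (simp add: hom_def cl flip: mult_lambda)
  ultimately show ?thesis
    using assms by (simp add: cl lambda_closed)
qed

lemma Omega_image:
  assumes f: "f \<in> brace_auto B" and N: "N \<in> Omega B"
  shows "f ` N \<in> Omega B"
proof -
  have hom: "f \<in> hom B B" and surj: "f ` carrier B = carrier B"
    using f by (auto simp: brace_auto_def auto_def Bij_def bij_betw_def)
  interpret f: group_hom B B f
    using hom by unfold_locales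
  have nN: "N \<lhd> B" and kN: "N \<subseteq> ker_lambda B"
    using N by (auto simp: Omega_def)
  have "f ` N \<lhd> B"
    by (rule normal.surj_hom_normal_subgroup[OF nN f.group_hom_axioms surj])
  moreover have "f n \<in> ker_lambda B" if "n \<in> N" for n
  proof -
    have n: "n \<in> carrier B" "\<And>b. b \<in> carrier B \<Longrightarrow> brace_lambda B n b = b"
      using kN that by (auto simp: ker_lambda_iff)
    have "brace_lambda B (f n) b = b" if b: "b \<in> carrier B" for b
    proof -
      obtain b' where "b = f b'" "b' \<in> carrier B"
        using b surj by force
      then show ?thesis
        using brace_auto_lambda[OF f n(1)] n(2) by simp
    qed
    then show ?thesis
      using n by (simp add: ker_lambda_iff)
  qed
  ultimately show ?thesis
    by (auto simp: Omega_def)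
qed

lemma Omega_subset: "N \<in> Omega B \<Longrightarrow> N \<subseteq> carrier B"
  by (auto simp: Omega_def kernel_def)

lemma Omega_group_action:
  "group_action (brace_AutoGroup B) (Omega B) (Omega_action B)"
proof -
  interpret A: group "brace_AutoGroup B" by (rule brace_AutoGroup)
  have carA: "carrier (brace_AutoGroup B) = brace_auto B"
    by (simp add: brace_AutoGroup_def)
  have Bij: "f \<in> Bij (carrier B)" if "f \<in> brace_auto B" for f
    using that by (simp add: brace_auto_def auto_def)
  have multA: "f \<otimes>\<^bsub>brace_AutoGroup B\<^esub> g = compose (carrier B) f g"
    if "f \<in> brace_auto B" "g \<in> brace_auto B" for f g
    using that by (simp add: brace_AutoGroup_def BijGroup_def Bij)
  have act: "Omega_action B f N = f ` N" if "N \<in> Omega B" for f N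
    using that by (simp add: Omega_action_def)
  have comp: "Omega_action B (f \<otimes>\<^bsub>brace_AutoGroup B\<^esub> g) N =
      Omega_action B f (Omega_action B g N)"
    if "f \<in> brace_auto B" "g \<in> brace_auto B" "N \<in> Omega B" for f g N
  proof -
    have "compose (carrier B) f g ` N = f ` g ` N"
      using Omega_subset[OF that(3)] by (force simp: compose_def image_iff)
    then show ?thesis
      using that by (simp add: act multA Omega_image)
  qed
  have one: "Omega_action B \<one>\<^bsub>brace_AutoGroup B\<^esub> N = N" if "N \<in> Omega B" for N
    using Omega_subset[OF that] that
    by (force simp: act brace_AutoGroup_def BijGroup_def image_iff)
  have closed: "Omega_action B f N \<in> Omega B" if "f \<in> brace_auto B" "N \<in> Omega B" for f N
    using that by (simp add: act Omega_image)
  have inB: "Omega_action B f \<in> Bij (Omega B)" if f: "f \<in> brace_auto B" for f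
  proof -
    let ?g = "inv\<^bsub>brace_AutoGroup B\<^esub> f"
    have g: "?g \<in> brace_auto B"
      using f A.inv_closed by (simp add: carA)
    have "bij_betw (Omega_action B f) (Omega B) (Omega B)"
      by (rule bij_betw_byWitness[where f' = "Omega_action B ?g"])
        (use f g in \<open>auto simp: closed one carA simp flip: comp\<close>)
    then show ?thesis
      by (simp add: Bij_def Omega_action_def)
  qed
  have "Omega_action B \<in> hom (brace_AutoGroup B) (BijGroup (Omega B))"
  proof (rule homI)
    show "Omega_action B f \<in> carrier (BijGroup (Omega B))"
      if "f \<in> carrier (brace_AutoGroup B)" for f
      using that by (simp add: BijGroup_def inB carA)
    show "Omega_action B (f \<otimes>\<^bsub>brace_AutoGroup B\<^esub> g) =
        Omega_action B f \<otimes>\<^bsub>BijGroup (Omega B)\<^esub> Omega_action B g"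
      if "f \<in> carrier (brace_AutoGroup B)" "g \<in> carrier (brace_AutoGroup B)" for f g
    proof
      fix N
      show "Omega_action B (f \<otimes>\<^bsub>brace_AutoGroup B\<^esub> g) N =
          (Omega_action B f \<otimes>\<^bsub>BijGroup (Omega B)\<^esub> Omega_action B g) N"
        using that
        by (cases "N \<in> Omega B")
          (simp_all add: BijGroup_def inB carA compose_def comp, simp add: Omega_action_def)
    qed
  qed
  then show ?thesis
    by (simp add: group_action_def group_hom_def group_hom_axioms_def A.is_group group_BijGroup)
qed

end

end

theory Submission
  imports Defs
begin

text \<open>The reason behind the theorem is that an isomorphism between two trifactorised groups
  associated with \<open>B\<close> is the same thing as a brace automorphism carrying one kernel onto the other.

  Inside the semidirect product of \<open>K\<close> and \<open>E\<close>, the three subgroups are \<open>K\<close>, \<open>E\<close> and the graph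
  \<open>H\<close> of \<open>\<eta>\<close>. A morphism that respects \<open>K\<close> and \<open>E\<close> acts coordinatewise, as
  \<open>(x, e) \<mapsto> (f x, g e)\<close>, where \<open>f\<close> is additive and \<open>g\<close> is a homomorphism. It respects the graphs
  exactly when \<open>g (\<eta>\<^sub>1 c) = \<eta>\<^sub>2 (f c)\<close>; as the graph is a copy of the multiplicative group, \<open>f\<close> is then
  multiplicative too, so it is a brace automorphism when the morphism is bijective, and
  injectivity of \<open>g\<close> makes \<open>f\<close> map \<open>ker \<eta>\<^sub>1\<close> onto \<open>ker \<eta>\<^sub>2\<close>. Conversely, a brace
  automorphism that maps \<open>ker \<eta>\<^sub>1\<close> onto \<open>ker \<eta>\<^sub>2\<close> induces such a \<open>g\<close>, and the resulting
  coordinatewise map is a homomorphism because brace automorphisms are compatible with \<open>\<lambda>\<close>.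

  Hence the isomorphism type of an associated trifactorised group is recorded exactly by the orbit
  of its kernel (\<open>associated_trifact_iso_iff\<close>). The kernel of \<open>\<eta>\<close> can be any member \<open>N\<close> of \<open>\<Omega>\<close>,
  since the natural epimorphism modulo \<open>N\<close> has kernel \<open>N\<close>. The bijection sends an orbit to
  the set of all associated trifactorised groups whose kernel lies in it.\<close>

section \<open>The associated trifactorised groups in coordinates\<close>

context skew_left_brace
begin

interpretation add: group "add_monoid B"
  rewrites "carrier (add_monoid B) = carrier B"
    and "mult (add_monoid B) = add B"
    and "one (add_monoid B) = zero B"
    and "m_inv (add_monoid B) = a_inv B"
  using additive_group by (auto simp: a_inv_def fun_eq_iff)

interpretation mul: group B
  by (rule multiplicative_group)

lemma admissible_hom:
  assumes "admissible B E \<eta>" shows "group_hom B E \<eta>"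
  using assms by (auto simp: admissible_def epi_def group_hom_def group_hom_axioms_def)

lemma admissible_image: "admissible B E \<eta> \<Longrightarrow> \<eta> ` carrier B = carrier E"
  by (simp add: admissible_def epi_def)

lemma admissible_kernel_in_Omega:
  assumes "admissible B E \<eta>" shows "kernel B E \<eta> \<in> Omega B"
  using assms group_hom.normal_kernel[OF admissible_hom[OF assms]]
  by (simp add: Omega_def admissible_def)

lemma natural_kernel:
  assumes "N \<in> Omega B" shows "kernel B (B Mod N) (\<lambda>c. N #> c) = N"
proof -
  interpret N: normal N B using assms by (simp add: Omega_def)
  show ?thesis
    using mul.rcos_self[OF _ N.is_subgroup] mul.coset_join2[OF _ N.is_subgroup] N.subset
    by (auto simp: kernel_def)
qed

lemma associated_carrier:
  "carrier (ambient (associated_trifact B E \<eta>)) = carrier B \<times> carrier E"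
  by (simp add: associated_trifact_def Let_def semidirect_def)

lemma associated_partK: "partK (associated_trifact B E \<eta>) = carrier B \<times> {\<one>\<^bsub>E\<^esub>}"
  and associated_partE: "partE (associated_trifact B E \<eta>) = {\<zero>} \<times> carrier E"
  by (simp_all add: associated_trifact_def Let_def)

lemma associated_mult:
  assumes "admissible B E \<eta>" "c \<in> carrier B"
  shows "(k, \<eta> c) \<otimes>\<^bsub>ambient (associated_trifact B E \<eta>)\<^esub> (k', e') =
    (k \<oplus> brace_lambda B c k', \<eta> c \<otimes>\<^bsub>E\<^esub> e')"
  using induced_action_eq[OF assms] by (simp add: associated_trifact_def Let_def semidirect_def)

lemma associated_mult_one:
  assumes adm: "admissible B E \<eta>" and "k' \<in> carrier B" "e' \<in> carrier E"
  shows "(k, \<one>\<^bsub>E\<^esub>) \<otimes>\<^bsub>ambient (associated_trifact B E \<eta>)\<^esub> (k', e') = (k \<oplus> k', e')"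
proof -
  interpret \<eta>: group_hom B E \<eta> by (rule admissible_hom[OF adm])
  show ?thesis
    using associated_mult[OF adm, of \<one>] assms by (simp add: lambda_one)
qed

text \<open>The subgroup \<open>H\<close> is the graph of \<open>\<eta>\<close>. This is how the multiplicative group of \<open>B\<close> enters the
  structure of the trifactorised group.\<close>

lemma associated_partH:
  assumes adm: "admissible B E \<eta>"
  shows "partH (associated_trifact B E \<eta>) = (\<lambda>c. (c, \<eta> c)) ` carrier B"
proof -
  interpret \<eta>: group_hom B E \<eta> by (rule admissible_hom[OF adm])
  have "partH (associated_trifact B E \<eta>) =
      {(c, \<one>\<^bsub>E\<^esub>) \<otimes>\<^bsub>ambient (associated_trifact B E \<eta>)\<^esub> (\<zero>, \<eta> c) | c. c \<in> carrier B}"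
    by (simp add: associated_trifact_def Let_def)
  also have "\<dots> = (\<lambda>c. (c, \<eta> c)) ` carrier B"
    unfolding Setcompr_eq_image by (rule image_cong) (auto simp: associated_mult_one[OF adm])
  finally show ?thesis .
qed

section \<open>Isomorphisms and brace automorphisms\<close>

lemma brace_autoI:
  assumes bij: "bij_betw f (carrier B) (carrier B)" and ext: "f \<in> extensional (carrier B)"
    and "\<And>x y. \<lbrakk>x \<in> carrier B; y \<in> carrier B\<rbrakk> \<Longrightarrow> f (x \<oplus> y) = f x \<oplus> f y"
    and "\<And>x y. \<lbrakk>x \<in> carrier B; y \<in> carrier B\<rbrakk> \<Longrightarrow> f (x \<otimes> y) = f x \<otimes> f y"
  shows "f \<in> brace_auto B"
  using assms bij_betwE[OF bij] by (auto simp: brace_auto_def auto_def Bij_def hom_def)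

lemma brace_autoD:
  assumes "f \<in> brace_auto B"
  shows "bij_betw f (carrier B) (carrier B)"
    and "\<And>x. x \<in> carrier B \<Longrightarrow> f x \<in> carrier B"
    and "\<And>x y. \<lbrakk>x \<in> carrier B; y \<in> carrier B\<rbrakk> \<Longrightarrow> f (x \<oplus> y) = f x \<oplus> f y"
    and "\<And>x y. \<lbrakk>x \<in> carrier B; y \<in> carrier B\<rbrakk> \<Longrightarrow> f (x \<otimes> y) = f x \<otimes> f y"
  using assms by (auto simp: brace_auto_def auto_def Bij_def hom_def)

text \<open>An isomorphism restricts to bijections of \<open>K\<close> and of \<open>E\<close>. The restriction to \<open>K\<close> preserves
  multiplication as well as addition, because elements of \<open>H\<close> are determined by their first
  coordinate, and \<open>c \<mapsto> (c, \<eta> c)\<close> is multiplicative.\<close>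

lemma iso_imp_brace_auto:
  assumes adm1: "admissible B E\<^sub>1 \<eta>\<^sub>1" and adm2: "admissible B E\<^sub>2 \<eta>\<^sub>2"
    and iso: "associated_trifact B E\<^sub>1 \<eta>\<^sub>1 \<cong>\<^sub>T associated_trifact B E\<^sub>2 \<eta>\<^sub>2"
  shows "\<exists>f \<in> brace_auto B. f ` kernel B E\<^sub>1 \<eta>\<^sub>1 = kernel B E\<^sub>2 \<eta>\<^sub>2"
proof -
  define T1 where "T1 = associated_trifact B E\<^sub>1 \<eta>\<^sub>1"
  define T2 where "T2 = associated_trifact B E\<^sub>2 \<eta>\<^sub>2"
  interpret \<eta>1: group_hom B E\<^sub>1 \<eta>\<^sub>1 by (rule admissible_hom[OF adm1])
  interpret \<eta>2: group_hom B E\<^sub>2 \<eta>\<^sub>2 by (rule admissible_hom[OF adm2])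
  note car1 = associated_carrier[of E\<^sub>1 \<eta>\<^sub>1, folded T1_def]
  note car2 = associated_carrier[of E\<^sub>2 \<eta>\<^sub>2, folded T2_def]
  note mult1 = associated_mult[OF adm1, folded T1_def] associated_mult_one[OF adm1, folded T1_def]
  note mult2 = associated_mult[OF adm2, folded T2_def] associated_mult_one[OF adm2, folded T2_def]
  obtain \<Phi> where mor: "\<Phi> \<in> trifact_morphism T1 T2"
    and bij: "bij_betw \<Phi> (carrier (ambient T1)) (carrier (ambient T2))"
    using iso unfolding trifact_iso_def T1_def T2_def by blast
  have hom: "\<Phi> (x \<otimes>\<^bsub>ambient T1\<^esub> y) = \<Phi> x \<otimes>\<^bsub>ambient T2\<^esub> \<Phi> y"
    if "x \<in> carrier B \<times> carrier E\<^sub>1" "y \<in> carrier B \<times> carrier E\<^sub>1" for x y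
    using hom_mult[of \<Phi> "ambient T1" "ambient T2" x y] mor that
    unfolding trifact_morphism_def car1 by blast
  have inj: "inj_on \<Phi> (carrier B \<times> carrier E\<^sub>1)"
    and surj: "\<Phi> ` (carrier B \<times> carrier E\<^sub>1) = carrier B \<times> carrier E\<^sub>2"
    using bij by (simp_all add: bij_betw_def car1 car2)

  define f where "f = (\<lambda>x \<in> carrier B. fst (\<Phi> (x, \<one>\<^bsub>E\<^sub>1\<^esub>)))"
  define g where "g e = snd (\<Phi> (\<zero>, e))" for e
  have \<Phi>K: "\<Phi> (x, \<one>\<^bsub>E\<^sub>1\<^esub>) = (f x, \<one>\<^bsub>E\<^sub>2\<^esub>)" "f x \<in> carrier B" if "x \<in> carrier B" for x
  proof -
    have "\<Phi> (x, \<one>\<^bsub>E\<^sub>1\<^esub>) \<in> carrier B \<times> {\<one>\<^bsub>E\<^sub>2\<^esub>}"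
      using mor that by (auto simp: trifact_morphism_def T1_def T2_def associated_partK)
    then show "\<Phi> (x, \<one>\<^bsub>E\<^sub>1\<^esub>) = (f x, \<one>\<^bsub>E\<^sub>2\<^esub>)" "f x \<in> carrier B"
      using that by (auto simp: f_def)
  qed
  have \<Phi>E: "\<Phi> (\<zero>, e) = (\<zero>, g e)" "g e \<in> carrier E\<^sub>2" if "e \<in> carrier E\<^sub>1" for e
  proof -
    have "\<Phi> (\<zero>, e) \<in> {\<zero>} \<times> carrier E\<^sub>2"
      using mor that by (auto simp: trifact_morphism_def T1_def T2_def associated_partE)
    then show "\<Phi> (\<zero>, e) = (\<zero>, g e)" "g e \<in> carrier E\<^sub>2"
      by (auto simp: g_def)
  qed
  have \<Phi>: "\<Phi> (x, e) = (f x, g e)" if "x \<in> carrier B" "e \<in> carrier E\<^sub>1" for x e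
    using hom[of "(x, \<one>\<^bsub>E\<^sub>1\<^esub>)" "(\<zero>, e)"] that by (simp add: mult1 mult2 \<Phi>K \<Phi>E)
  have g\<eta>: "g (\<eta>\<^sub>1 c) = \<eta>\<^sub>2 (f c)" if c: "c \<in> carrier B" for c
  proof -
    have "\<Phi> (c, \<eta>\<^sub>1 c) \<in> (\<lambda>c. (c, \<eta>\<^sub>2 c)) ` carrier B"
      using mor c
      by (auto simp: trifact_morphism_def T1_def T2_def associated_partH[OF adm1]
          associated_partH[OF adm2])
    then show ?thesis
      using c by (auto simp: \<Phi>)
  qed
  have g_one: "g \<one>\<^bsub>E\<^sub>1\<^esub> = \<one>\<^bsub>E\<^sub>2\<^esub>"
    using \<Phi>K[of \<zero>] by (simp add: g_def)

  have f_add: "f (x \<oplus> y) = f x \<oplus> f y" if "x \<in> carrier B" "y \<in> carrier B" for x y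
    using hom[of "(x, \<one>\<^bsub>E\<^sub>1\<^esub>)" "(y, \<one>\<^bsub>E\<^sub>1\<^esub>)"] that by (simp add: mult1 mult2 \<Phi>K)
  \<comment> \<open>compare first coordinates in the image of a product of two elements of the graph of \<open>\<eta>\<^sub>1\<close>\<close>
  have f_mult: "f (x \<otimes> y) = f x \<otimes> f y" if "x \<in> carrier B" "y \<in> carrier B" for x y
    using hom[of "(x, \<eta>\<^sub>1 x)" "(y, \<eta>\<^sub>1 y)"] that
    by (simp add: mult1 mult2 \<Phi> \<Phi>K g\<eta> flip: mult_lambda)
  have f_inj: "inj_on f (carrier B)"
  proof (rule inj_onI)
    fix x y assume "x \<in> carrier B" "y \<in> carrier B" "f x = f y"
    then show "x = y"
      using inj_onD[OF inj, of "(x, \<one>\<^bsub>E\<^sub>1\<^esub>)" "(y, \<one>\<^bsub>E\<^sub>1\<^esub>)"] by (simp add: \<Phi>K)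
  qed
  have f_surj: "f ` carrier B = carrier B"
  proof
    show "carrier B \<subseteq> f ` carrier B"
    proof
      fix y assume "y \<in> carrier B"
      then have "(y, \<one>\<^bsub>E\<^sub>2\<^esub>) \<in> \<Phi> ` (carrier B \<times> carrier E\<^sub>1)"
        by (simp add: surj)
      then show "y \<in> f ` carrier B"
        by (auto simp: \<Phi>)
    qed
  qed (auto simp: \<Phi>K)
  have "f \<in> brace_auto B"
    by (rule brace_autoI) (use f_inj f_surj f_add f_mult in \<open>auto simp: bij_betw_def f_def\<close>)
  moreover have ker: "c \<in> kernel B E\<^sub>1 \<eta>\<^sub>1 \<longleftrightarrow> f c \<in> kernel B E\<^sub>2 \<eta>\<^sub>2" if c: "c \<in> carrier B" for c
  proof
    assume "c \<in> kernel B E\<^sub>1 \<eta>\<^sub>1"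
    then show "f c \<in> kernel B E\<^sub>2 \<eta>\<^sub>2"
      using c g\<eta>[OF c] by (simp add: kernel_def \<Phi>K g_one)
  next
    assume "f c \<in> kernel B E\<^sub>2 \<eta>\<^sub>2"
    then have "\<Phi> (\<zero>, \<eta>\<^sub>1 c) = \<Phi> (\<zero>, \<one>\<^bsub>E\<^sub>1\<^esub>)"
      using c by (simp add: kernel_def \<Phi>E g\<eta> g_one)
    then show "c \<in> kernel B E\<^sub>1 \<eta>\<^sub>1"
      using inj_onD[OF inj, of "(\<zero>, \<eta>\<^sub>1 c)" "(\<zero>, \<one>\<^bsub>E\<^sub>1\<^esub>)"] c by (simp add: kernel_def)
  qed
  have "f ` kernel B E\<^sub>1 \<eta>\<^sub>1 = kernel B E\<^sub>2 \<eta>\<^sub>2"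
  proof
    show "f ` kernel B E\<^sub>1 \<eta>\<^sub>1 \<subseteq> kernel B E\<^sub>2 \<eta>\<^sub>2"
      using ker by (auto simp: kernel_def)
    show "kernel B E\<^sub>2 \<eta>\<^sub>2 \<subseteq> f ` kernel B E\<^sub>1 \<eta>\<^sub>1"
    proof
      fix y assume y: "y \<in> kernel B E\<^sub>2 \<eta>\<^sub>2"
      then have "y \<in> f ` carrier B"
        by (simp add: kernel_def f_surj)
      then show "y \<in> f ` kernel B E\<^sub>1 \<eta>\<^sub>1"
        using ker y by blast
    qed
  qed
  ultimately show ?thesis by blast
qed

text \<open>As \<open>f\<close> matches the kernels, \<open>\<eta>\<^sub>1 c \<mapsto> \<eta>\<^sub>2 (f c)\<close> is a well defined injection. The map
  \<open>f \<times> g\<close> respects the semidirect multiplication because \<open>f\<close> intertwines \<open>\<lambda>\<^sub>c\<close> with \<open>\<lambda>\<^bsub>f c\<^esub>\<close>.\<close>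

lemma brace_auto_imp_iso:
  assumes adm1: "admissible B E\<^sub>1 \<eta>\<^sub>1" and adm2: "admissible B E\<^sub>2 \<eta>\<^sub>2"
    and f: "f \<in> brace_auto B" and ker: "f ` kernel B E\<^sub>1 \<eta>\<^sub>1 = kernel B E\<^sub>2 \<eta>\<^sub>2"
  shows "associated_trifact B E\<^sub>1 \<eta>\<^sub>1 \<cong>\<^sub>T associated_trifact B E\<^sub>2 \<eta>\<^sub>2"
proof -
  define T1 where "T1 = associated_trifact B E\<^sub>1 \<eta>\<^sub>1"
  define T2 where "T2 = associated_trifact B E\<^sub>2 \<eta>\<^sub>2"
  interpret \<eta>1: group_hom B E\<^sub>1 \<eta>\<^sub>1 by (rule admissible_hom[OF adm1])
  interpret \<eta>2: group_hom B E\<^sub>2 \<eta>\<^sub>2 by (rule admissible_hom[OF adm2])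
  note car1 = associated_carrier[of E\<^sub>1 \<eta>\<^sub>1, folded T1_def]
  note car2 = associated_carrier[of E\<^sub>2 \<eta>\<^sub>2, folded T2_def]
  note mult1 = associated_mult[OF adm1, folded T1_def]
  note mult2 = associated_mult[OF adm2, folded T2_def]
  note f_props = brace_autoD[OF f]
  interpret f: group_hom B B f
    by unfold_locales (auto simp: hom_def f_props)
  have f_inj: "inj_on f (carrier B)" and f_surj: "f ` carrier B = carrier B"
    using f_props(1) by (simp_all add: bij_betw_def)
  have f_zero: "f \<zero> = \<zero>"
    using f.hom_one by (simp add: one_eq_zero)
  have ker_iff: "c \<in> kernel B E\<^sub>1 \<eta>\<^sub>1 \<longleftrightarrow> f c \<in> kernel B E\<^sub>2 \<eta>\<^sub>2" if c: "c \<in> carrier B" for c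
    unfolding ker[symmetric]
    using c by (subst inj_on_image_mem_iff[OF f_inj]) (auto simp: kernel_def)
  have eq_iff: "\<eta>\<^sub>1 c = \<eta>\<^sub>1 d \<longleftrightarrow> \<eta>\<^sub>2 (f c) = \<eta>\<^sub>2 (f d)"
    if cd: "c \<in> carrier B" "d \<in> carrier B" for c d
  proof -
    have "\<eta>\<^sub>1 c = \<eta>\<^sub>1 d \<longleftrightarrow> c \<otimes> inv d \<in> kernel B E\<^sub>1 \<eta>\<^sub>1"
      using cd \<eta>1.inv_solve_right'[of "\<one>\<^bsub>E\<^sub>1\<^esub>" "\<eta>\<^sub>1 c" "\<eta>\<^sub>1 d"] by (auto simp: kernel_def)
    also have "\<dots> \<longleftrightarrow> f c \<otimes> inv (f d) \<in> kernel B E\<^sub>2 \<eta>\<^sub>2"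
      using cd by (simp add: ker_iff)
    also have "\<dots> \<longleftrightarrow> \<eta>\<^sub>2 (f c) = \<eta>\<^sub>2 (f d)"
      using cd \<eta>2.inv_solve_right'[of "\<one>\<^bsub>E\<^sub>2\<^esub>" "\<eta>\<^sub>2 (f c)" "\<eta>\<^sub>2 (f d)"] by (auto simp: kernel_def)
    finally show ?thesis .
  qed

  define g where "g e = \<eta>\<^sub>2 (f (inv_into (carrier B) \<eta>\<^sub>1 e))" for e
  have g\<eta>: "g (\<eta>\<^sub>1 c) = \<eta>\<^sub>2 (f c)" if c: "c \<in> carrier B" for c
  proof -
    have "\<eta>\<^sub>1 c \<in> \<eta>\<^sub>1 ` carrier B" using c by blast
    from inv_into_into[OF this] f_inv_into_f[OF this] show ?thesis
      using c by (simp add: g_def flip: eq_iff)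
  qed
  have surj1: "\<exists>c\<in>carrier B. e = \<eta>\<^sub>1 c" if "e \<in> carrier E\<^sub>1" for e
    using that admissible_image[OF adm1] by blast
  have surj2: "\<exists>c\<in>carrier B. e = \<eta>\<^sub>2 (f c)" if "e \<in> carrier E\<^sub>2" for e
  proof -
    obtain d where d: "d \<in> carrier B" "e = \<eta>\<^sub>2 d"
      using \<open>e \<in> carrier E\<^sub>2\<close> admissible_image[OF adm2] by blast
    then obtain c where "c \<in> carrier B" "d = f c"
      using f_surj by blast
    with d show ?thesis by blast
  qed
  have g_bij: "bij_betw g (carrier E\<^sub>1) (carrier E\<^sub>2)"
    unfolding bij_betw_def
  proof
    show "inj_on g (carrier E\<^sub>1)"
    proof (rule inj_onI)
      fix d e assume de: "d \<in> carrier E\<^sub>1" "e \<in> carrier E\<^sub>1" "g d = g e"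
      obtain a where "a \<in> carrier B" "d = \<eta>\<^sub>1 a" using surj1 de(1) by blast
      moreover obtain b where "b \<in> carrier B" "e = \<eta>\<^sub>1 b" using surj1 de(2) by blast
      ultimately show "d = e"
        using de(3) by (simp add: g\<eta> eq_iff)
    qed
    show "g ` carrier E\<^sub>1 = carrier E\<^sub>2"
    proof
      show "g ` carrier E\<^sub>1 \<subseteq> carrier E\<^sub>2"
        using surj1 g\<eta> f_props(2) by fastforce
      show "carrier E\<^sub>2 \<subseteq> g ` carrier E\<^sub>1"
      proof
        fix e assume "e \<in> carrier E\<^sub>2"
        then obtain c where "c \<in> carrier B" "e = g (\<eta>\<^sub>1 c)"
          using surj2 g\<eta> by metis
        then show "e \<in> g ` carrier E\<^sub>1" by simp
      qed
    qed
  qed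

  have "bij_betw (map_prod f g) (carrier (ambient T1)) (carrier (ambient T2))"
    unfolding car1 car2
    by (rule bij_betw_map_prod[OF f_props(1) g_bij])
  moreover have "map_prod f g \<in> trifact_morphism T1 T2"
  proof -
    have "map_prod f g (x \<otimes>\<^bsub>ambient T1\<^esub> y) =
        map_prod f g x \<otimes>\<^bsub>ambient T2\<^esub> map_prod f g y"
      if "x \<in> carrier (ambient T1)" "y \<in> carrier (ambient T1)" for x y
    proof -
      obtain a c where x: "x = (a, \<eta>\<^sub>1 c)" "a \<in> carrier B" "c \<in> carrier B"
        using \<open>x \<in> _\<close> unfolding car1 by (blast dest: surj1)
      obtain b d where y: "y = (b, \<eta>\<^sub>1 d)" "b \<in> carrier B" "d \<in> carrier B"
        using \<open>y \<in> _\<close> unfolding car1 by (blast dest: surj1)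
      have "g (\<eta>\<^sub>1 c \<otimes>\<^bsub>E\<^sub>1\<^esub> \<eta>\<^sub>1 d) = g (\<eta>\<^sub>1 c) \<otimes>\<^bsub>E\<^sub>2\<^esub> g (\<eta>\<^sub>1 d)"
        using x y g\<eta>[of "c \<otimes> d"] by (simp add: g\<eta>)
      then show ?thesis
        using x y by (simp add: mult1 mult2 g\<eta> f_props lambda_closed brace_auto_lambda[OF f])
    qed
    moreover have "map_prod f g ` partK T1 \<subseteq> partK T2"
      using g\<eta>[of \<one>] by (auto simp: T1_def T2_def associated_partK)
    moreover have "map_prod f g ` partE T1 \<subseteq> partE T2"
      using bij_betwE[OF g_bij] by (auto simp: T1_def T2_def associated_partE f_zero)
    moreover have "map_prod f g ` partH T1 \<subseteq> partH T2"
      by (auto simp: T1_def T2_def associated_partH[OF adm1] associated_partH[OF adm2] g\<eta>)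
    moreover have "map_prod f g ` carrier (ambient T1) \<subseteq> carrier (ambient T2)"
      using f_props(2) bij_betwE[OF g_bij] by (auto simp: car1 car2)
    ultimately show ?thesis
      by (auto simp: trifact_morphism_def hom_def)
  qed
  ultimately show ?thesis
    unfolding trifact_iso_def T1_def T2_def by blast
qed

section \<open>Isomorphism types and orbits\<close>

lemma Omega_orbit:
  assumes "N \<in> Omega B"
  shows "orbit (brace_AutoGroup B) (Omega_action B) N = {f ` N | f. f \<in> brace_auto B}"
  using assms by (simp add: orbit_def Omega_action_def brace_AutoGroup_def)

text \<open>The two groups \<open>E\<^sub>1\<close> and \<open>E\<^sub>2\<close> may live on different types; this is what lets groups
  on an arbitrary type be compared with quotients of the multiplicative group.\<close>

theorem associated_trifact_iso_iff:
  assumes adm1: "admissible B E\<^sub>1 \<eta>\<^sub>1" and adm2: "admissible B E\<^sub>2 \<eta>\<^sub>2"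
  shows "associated_trifact B E\<^sub>1 \<eta>\<^sub>1 \<cong>\<^sub>T associated_trifact B E\<^sub>2 \<eta>\<^sub>2 \<longleftrightarrow>
    kernel B E\<^sub>2 \<eta>\<^sub>2 \<in> orbit (brace_AutoGroup B) (Omega_action B) (kernel B E\<^sub>1 \<eta>\<^sub>1)"
  unfolding Omega_orbit[OF admissible_kernel_in_Omega[OF adm1]]
  using iso_imp_brace_auto[OF assms] brace_auto_imp_iso[OF assms] by blast

text \<open>For a fixed kernel \<open>N\<close>, the condition on the other group says that its kernel lies in the
  orbit of \<open>N\<close>, whence the class depends on the orbit alone.\<close>

lemma iso_class_natural:
  assumes N: "N \<in> Omega B"
  shows "(iso_class B (natural_trifact B N) :: ('a \<times> 'a set) trifact set) =
    {associated_trifact B E \<eta> | E \<eta>. admissible B E \<eta> \<and>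
       kernel B E \<eta> \<in> orbit (brace_AutoGroup B) (Omega_action B) N}"
  using associated_trifact_iso_iff[OF natural_admissible[OF N]]
  by (auto simp: iso_class_def associated_trifacts_def natural_kernel[OF N])

lemma natural_trifact_in_iso_class_iff:
  assumes N: "N \<in> Omega B" and M: "M \<in> Omega B"
  shows "natural_trifact B M \<in> iso_class B (natural_trifact B N) \<longleftrightarrow>
    M \<in> orbit (brace_AutoGroup B) (Omega_action B) N"
  using associated_trifact_iso_iff[OF natural_admissible[OF N] natural_admissible[OF M]]
    natural_admissible[OF M]
  by (auto simp: iso_class_def associated_trifacts_def natural_kernel N M)

lemma iso_class_associated:
  assumes adm: "admissible B E \<eta>"
  shows "(iso_class B (associated_trifact B E \<eta>) :: ('a \<times> 'a set) trifact set) =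
    iso_class B (natural_trifact B (kernel B E \<eta>))"
  unfolding iso_class_natural[OF admissible_kernel_in_Omega[OF adm]]
  using associated_trifact_iso_iff[OF adm]
  by (auto simp: iso_class_def associated_trifacts_def)

end

theorem theorem4p7:
  fixes B :: "('a, 'm) ring_scheme"
  assumes "skew_left_brace B"
  shows "\<exists>F. bij_betw F (orbits (brace_AutoGroup B) (Omega B) (Omega_action B))
                        (iso_classes B :: ('a \<times> 'a set) trifact set set)
           \<and> (\<forall>N \<in> Omega B. F (orbit (brace_AutoGroup B) (Omega_action B) N)
                             = iso_class B (natural_trifact B N))
           \<and> (\<forall>(E :: 'e monoid) \<eta>. admissible B E \<eta> \<longrightarrow>
                (\<exists>!\<omega>. \<omega> \<in> orbits (brace_AutoGroup B) (Omega B) (Omega_action B) \<and>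
                      (\<forall>T \<in> F \<omega>. associated_trifact B E \<eta> \<cong>\<^sub>T T)))"
proof -
  interpret skew_left_brace B by fact
  interpret act: group_action "brace_AutoGroup B" "Omega B" "Omega_action B"
    by (rule Omega_group_action)
  let ?orb = "orbit (brace_AutoGroup B) (Omega_action B)"
  let ?orbs = "orbits (brace_AutoGroup B) (Omega B) (Omega_action B)"
  have orbit_eq: "?orb M = ?orb N" if "N \<in> Omega B" "M \<in> Omega B" "M \<in> ?orb N" for M N
  proof -
    have "?orb M \<in> ?orbs" "?orb N \<in> ?orbs"
      using that by (auto simp: orbits_def)
    then show ?thesis
      using act.disjoint_union act.orbit_refl[OF that(2)] that(3) by blast
  qed
  define F :: "'a set set \<Rightarrow> ('a \<times> 'a set) trifact set"
    where "F \<omega> = {associated_trifact B E \<eta> | E \<eta>. admissible B E \<eta> \<and> kernel B E \<eta> \<in> \<omega>}" for \<omega>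
  have F: "F (?orb N) = iso_class B (natural_trifact B N)" if "N \<in> Omega B" for N
    using iso_class_natural[OF that] by (simp add: F_def)
  have natural_in_F: "natural_trifact B M \<in> F (?orb N) \<longleftrightarrow> M \<in> ?orb N"
    if "N \<in> Omega B" "M \<in> Omega B" for M N
    using natural_trifact_in_iso_class_iff[OF that] by (simp add: F that)

  have "bij_betw F ?orbs (iso_classes B)"
    unfolding bij_betw_def
  proof
    show "inj_on F ?orbs"
    proof (rule inj_onI)
      fix v w assume "v \<in> ?orbs" "w \<in> ?orbs" and eq: "F v = F w"
      then obtain M N where MN: "M \<in> Omega B" "v = ?orb M" "N \<in> Omega B" "w = ?orb N"
        by (auto simp: orbits_def)
      then have "natural_trifact B M \<in> F v"
        using natural_in_F[OF MN(1) MN(1)] act.orbit_refl[OF MN(1)] by blast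
      then have "M \<in> ?orb N"
        using natural_in_F[OF MN(3) MN(1)] MN(4) eq by blast
      then show "v = w"
        using MN orbit_eq by blast
    qed
    show "F ` ?orbs = iso_classes B"
    proof
      show "F ` ?orbs \<subseteq> iso_classes B"
        using natural_admissible
        by (force simp: orbits_def F iso_classes_def associated_trifacts_def)
      show "iso_classes B \<subseteq> F ` ?orbs"
        using admissible_kernel_in_Omega
        by (force simp: orbits_def F iso_classes_def associated_trifacts_def iso_class_associated)
    qed
  qed
  moreover have "\<exists>!\<omega>. \<omega> \<in> ?orbs \<and> (\<forall>T \<in> F \<omega>. associated_trifact B E \<eta> \<cong>\<^sub>T T)"
    if adm: "admissible B E \<eta>" for E :: "'e monoid" and \<eta>
  proof
    let ?N = "kernel B E \<eta>"
    have N: "?N \<in> Omega B" by (rule admissible_kernel_in_Omega[OF adm])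
    show "?orb ?N \<in> ?orbs \<and> (\<forall>T \<in> F (?orb ?N). associated_trifact B E \<eta> \<cong>\<^sub>T T)"
      using N associated_trifact_iso_iff[OF adm] by (auto simp: orbits_def F_def)
    fix \<omega> assume \<omega>: "\<omega> \<in> ?orbs \<and> (\<forall>T \<in> F \<omega>. associated_trifact B E \<eta> \<cong>\<^sub>T T)"
    then obtain M where M: "M \<in> Omega B" "\<omega> = ?orb M"
      by (auto simp: orbits_def)
    \<comment> \<open>\<open>F \<omega>\<close> is not empty: it contains the natural trifactorised group of \<open>M\<close>\<close>
    have "associated_trifact B E \<eta> \<cong>\<^sub>T natural_trifact B M"
      using \<omega> M natural_in_F[of M M] act.orbit_refl by blast
    then have "M \<in> ?orb ?N"
      using associated_trifact_iso_iff[OF adm natural_admissible] M by (simp add: natural_kernel)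
    then show "\<omega> = ?orb ?N"
      using M N orbit_eq by blast
  qed
  ultimately show ?thesis
    using F by (intro exI[of _ F]) blast
qed

end
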